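(* Let $N\geq 1$, $p>1$, $\lambda>0$, let $A\in C^{1}(\mathbb{H}^{N}\setminus\{0\})$ and let $X$ be a (smooth) vector field on $\mathbb{H}^{N}$. Then for all $u\in C_{0}^{1}(\mathbb{H}^{N}\setminus\{0\})$, $$\lambda^{p}\int_{\mathbb{H}^{N}}A|\nabla_{\mathbb{H}}u|^{p}\,dV_{\mathbb{H}}+\frac{p-1}{\lambda^{p/(p-1)}}\int_{\mathbb{H}^{N}}A|uX|^{p}\,dV_{\mathbb{H}}=-\int_{\mathbb{H}^{N}}\operatorname{div}\left(A|X|^{p-2}X\right)|u|^{p}\,dV_{\mathbb{H}}+\int_{\mathbb{H}^{N}}A\,\mathcal{R}_{p}\left(\frac{uX}{\lambda^{1/(p-1)}},\lambda\nabla_{\mathbb{H}}u\right)dV_{\mathbb{H}},$$ where $\mathcal{R}_{p}(X,Y):=|Y|^{p}+(p-1)|X|^{p}-p|X|^{p-2}\langle X,Y\rangle$ for tangent vectors $X,Y$ at the same point.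
   Context: $\mathbb{H}^{N}$ is the hyperbolic space in the Poincaré ball model: the Euclidean unit ball $\{x\in\mathbb{R}^{N}:|x|<1\}$ with Riemannian metric $\left(\frac{2}{1-|x|^{2}}\right)^{2}dx^{2}$; its volume element is $dV_{\mathbb{H}}=\left(\frac{2}{1-|x|^{2}}\right)^{N}dx$ and $0$ is the center of the ball. $\nabla_{\mathbb{H}}=\left(\frac{1-|x|^{2}}{2}\right)^{2}\nabla$ is the Riemannian gradient ($\nabla$ the Euclidean gradient). For tangent vectors, $\langle\cdot,\cdot\rangle$ and $|\cdot|$ are the Riemannian inner product and norm. Functions are real-valued. $C^1_0(\Omega)$ denotes compactly supported $C^1$ functions in $\Omega$. The expressions $|X|^{p-2}X$ and $|X|^{p-2}\langle X,Y\rangle$ are read as $0$ where $X=0$. The divergence of a vector field $Y$ is given in coordinates by $\operatorname{div}Y=\frac{1}{\sqrt{\det g}}\partial_{i}(Y^{i}\sqrt{\det g})$ with $g$ the metric matrix; it is characterized by $\int_{\mathbb{H}^{N}}(\operatorname{div}Y)\,w\,dV_{\mathbb{H}}=-\int_{\mathbb{H}^{N}}\langle Y,\nabla_{\mathbb{H}}w\rangle\,dV_{\mathbb{H}}$ for compactly supported $w$ (and is understood in this weak sense wherever $Y$ is only continuous). *)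

theory Defs
  imports "HOL-Analysis.Analysis"
begin

definition partial_deriv :: "'n::finite \<Rightarrow> (real^'n \<Rightarrow> real) \<Rightarrow> real^'n \<Rightarrow> real" where
  "partial_deriv i f x = deriv (\<lambda>t::real. f (x + t *\<^sub>R axis i 1)) 0"

definition gradient :: "(real^'n::finite \<Rightarrow> real) \<Rightarrow> real^'n \<Rightarrow> real^'n" where
  "gradient f x = (\<chi> i. partial_deriv i f x)"

(* Meant for open S. *)
primrec Ck_on :: "nat \<Rightarrow> (real^'n::finite) set \<Rightarrow> (real^'n \<Rightarrow> real) \<Rightarrow> bool" where
  "Ck_on 0 S f \<longleftrightarrow> continuous_on S f"
| "Ck_on (Suc k) S f \<longleftrightarrow>
     (\<forall>x\<in>S. f differentiable (at x)) \<and> (\<forall>i. Ck_on k S (partial_deriv i f))"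

abbreviation C1_on :: "(real^'n::finite) set \<Rightarrow> (real^'n \<Rightarrow> real) \<Rightarrow> bool" where
  "C1_on \<equiv> Ck_on 1"

definition C1_vector_field_on :: "(real^'n::finite) set \<Rightarrow> (real^'n \<Rightarrow> real^'n) \<Rightarrow> bool" where
  "C1_vector_field_on S Y \<longleftrightarrow> (\<forall>i. C1_on S (\<lambda>x. Y x $ i))"

definition smooth_vector_field_on :: "(real^'n::finite) set \<Rightarrow> (real^'n \<Rightarrow> real^'n) \<Rightarrow> bool" where
  "smooth_vector_field_on S Y \<longleftrightarrow> (\<forall>k i. Ck_on k S (\<lambda>x. Y x $ i))"

(* Functions are total in HOL; the values of u outside S are irrelevant here, as are
   those of A and u at 0 and outside the ball in everything below. *)
definition supported_in :: "'a::topological_space set \<Rightarrow> 'a set \<Rightarrow> ('a \<Rightarrow> real) \<Rightarrow> bool" where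
  "supported_in K S u \<longleftrightarrow> compact K \<and> K \<subseteq> S \<and> (\<forall>x\<in>S - K. u x = 0)"

definition C1_0 :: "(real^'n::finite) set \<Rightarrow> (real^'n \<Rightarrow> real) set" where
  "C1_0 S = {u. C1_on S u \<and> (\<exists>K. supported_in K S u)}"

(* Vector fields are given by their components in the global coordinates of the ball,
   so a tangent vector at any point is an element of real^'n. *)
abbreviation hyp :: "(real^'n::finite) set" where
  "hyp \<equiv> ball 0 1"

definition metric_matrix :: "real^'n::finite \<Rightarrow> real^'n^'n" where
  "metric_matrix x = mat ((2 / (1 - (norm x)\<^sup>2))\<^sup>2)"

definition hyp_inner :: "real^'n::finite \<Rightarrow> real^'n \<Rightarrow> real^'n \<Rightarrow> real" where
  "hyp_inner x v w = v \<bullet> (metric_matrix x *v w)"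

definition hyp_norm :: "real^'n::finite \<Rightarrow> real^'n \<Rightarrow> real" where
  "hyp_norm x v = sqrt (hyp_inner x v v)"

definition hyp_volume :: "(real^'n::finite) measure" where
  "hyp_volume = density (restrict_space lborel hyp)
     (\<lambda>x. ennreal ((2 / (1 - (norm x)\<^sup>2)) ^ CARD('n)))"

definition hyp_grad :: "(real^'n::finite \<Rightarrow> real) \<Rightarrow> real^'n \<Rightarrow> real^'n" where
  "hyp_grad u x = ((1 - (norm x)\<^sup>2) / 2)\<^sup>2 *\<^sub>R gradient u x"

definition hyp_div :: "(real^'n::finite \<Rightarrow> real^'n) \<Rightarrow> real^'n \<Rightarrow> real" where
  "hyp_div Y x = 1 / sqrt (det (metric_matrix x)) *
     (\<Sum>i\<in>UNIV. partial_deriv i (\<lambda>y. Y y $ i * sqrt (det (metric_matrix y))) x)"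

(* The integral of (div Y) w over hyperbolic space, for Y on the punctured ball and w
   compactly supported there: with the coordinate divergence if Y is C^1 near the support
   of w, and in the weak sense otherwise. The field A |X|^(p-2) X is continuous, but for p < 2
   it need not be C^1 at the zeros of X. *)
definition div_integral :: "(real^'n::finite \<Rightarrow> real^'n) \<Rightarrow> (real^'n \<Rightarrow> real) \<Rightarrow> real" where
  "div_integral Y w =
     (if \<exists>U K. open U \<and> K \<subseteq> U \<and> supported_in K (hyp - {0}) w \<and> C1_vector_field_on U Y
      then \<integral>x. hyp_div Y x * w x \<partial>hyp_volume
      else - (\<integral>x. hyp_inner x (Y x) (hyp_grad w x) \<partial>hyp_volume))"

(* Since 0 powr a = 0 for every a, the terms with |X|^(p-2) vanish where X = 0, as intended,
   also for p <= 2; the same applies to A |X|^(p-2) X in the theorem. *)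
definition R_p :: "real \<Rightarrow> real^'n::finite \<Rightarrow> real^'n \<Rightarrow> real^'n \<Rightarrow> real" where
  "R_p p x X Y = hyp_norm x Y powr p + (p - 1) * hyp_norm x X powr p
     - p * hyp_norm x X powr (p - 2) * hyp_inner x X Y"

end

theory Submission
  imports Defs
begin

text \<open>Expanding \<open>\<R>\<^sub>p\<close>, the powers of \<open>\<lambda>\<close> in the mixed term cancel, and that term becomes
  \<open>A |X|\<^sup>p\<^sup>-\<^sup>2\<langle>X, \<nabla>(|u|\<^sup>p)\<rangle>\<close>. The identity then reduces to integration by parts against \<open>|u|\<^sup>p\<close>, which is
  \<open>C\<^sup>1\<close> as \<open>p > 1\<close>. In coordinates the hyperbolic volume density is absorbed into the components of
  the field, so only \<open>\<integral> \<partial>\<^sub>i f = 0\<close> for compactly supported \<open>f\<close> on Euclidean space is needed.\<close>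

section \<open>Partial derivatives along the axes and the class C^1\<close>

text \<open>\<open>partial_deriv\<close> is built on \<open>deriv\<close>, which carries information
  only where a derivative exists; the chain rule along the line through \<open>x\<close> supplies
  that existence.\<close>

lemma has_partial_deriv:
  assumes "f differentiable (at x)"
  shows "((\<lambda>t. f (x + t *\<^sub>R axis i 1)) has_real_derivative partial_deriv i f x) (at 0)"
proof -
  have "f differentiable (at (x + 0 *\<^sub>R axis i 1))"
    using assms by simp
  moreover have "(\<lambda>t. x + t *\<^sub>R axis i 1) differentiable (at (0::real))"
    by (intro differentiableI derivative_intros)
  ultimately have "(f \<circ> (\<lambda>t. x + t *\<^sub>R axis i 1)) differentiable (at 0)"
    by (intro differentiable_chain_at) auto
  then show ?thesis
    unfolding partial_deriv_def o_def
    by (simp add: DERIV_deriv_iff_real_differentiable)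
qed

text \<open>Differentiation is local. Since functions are total with arbitrary values off the
  relevant set, derivatives must pass between functions that agree only near the point.\<close>

lemma has_real_derivative_along_axis_cong:
  fixes f g :: "real^'n::finite \<Rightarrow> real"
  assumes "((\<lambda>t. f (x + t *\<^sub>R axis i 1)) has_real_derivative d) (at 0)"
    and "open S" "x \<in> S" "\<And>y. y \<in> S \<Longrightarrow> f y = g y"
  shows "((\<lambda>t. g (x + t *\<^sub>R axis i 1)) has_real_derivative d) (at 0)"
proof (rule has_field_derivative_transform_within_open[OF assms(1)])
  show "open ((\<lambda>t. x + t *\<^sub>R axis i 1) -` S)"
    by (intro open_vimage assms continuous_intros)
qed (use assms in auto)

lemma partial_deriv_eqI:
  assumes "((\<lambda>t. f (x + t *\<^sub>R axis i 1)) has_real_derivative d) (at 0)"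
  shows "partial_deriv i f x = d"
  using DERIV_imp_deriv[OF assms] by (simp add: partial_deriv_def)

lemma partial_deriv_mult:
  assumes "f differentiable (at x)" "g differentiable (at x)"
  shows "partial_deriv i (\<lambda>y. f y * g y) x
    = partial_deriv i f x * g x + f x * partial_deriv i g x"
  by (rule partial_deriv_eqI)
    (use DERIV_mult[OF has_partial_deriv[OF assms(1)] has_partial_deriv[OF assms(2)], of i i]
      in \<open>simp add: algebra_simps\<close>)

lemma partial_deriv_zero:
  assumes "open S" "x \<in> S" "\<And>y. y \<in> S \<Longrightarrow> f y = 0"
  shows "partial_deriv i f x = 0"
  by (rule partial_deriv_eqI, rule has_real_derivative_along_axis_cong[of "\<lambda>_. 0" _ _ _ S])
    (use assms in auto)

lemma C1_on_iff:
  "C1_on S f \<longleftrightarrow> (\<forall>x\<in>S. f differentiable (at x)) \<and> (\<forall>i. continuous_on S (partial_deriv i f))"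
  by simp

lemma C1_on_imp_continuous_on:
  assumes "C1_on S f"
  shows "continuous_on S f"
  using assms by (auto intro!: continuous_at_imp_continuous_on differentiable_imp_continuous_within)

lemma C1_on_mult:
  assumes "C1_on S f" "C1_on S g"
  shows "C1_on S (\<lambda>x. f x * g x)"
proof -
  have "continuous_on S (partial_deriv i (\<lambda>x. f x * g x))" for i
  proof (rule continuous_on_eq)
    show "continuous_on S (\<lambda>x. partial_deriv i f x * g x + f x * partial_deriv i g x)"
      using assms
      by (intro continuous_on_add continuous_on_mult) (auto intro!: C1_on_imp_continuous_on)
  qed (use assms in \<open>simp add: partial_deriv_mult\<close>)
  then show ?thesis
    using assms by simp
qed

lemma C1_on_subset:
  assumes "C1_on S f" "T \<subseteq> S"
  shows "C1_on T f"
  using assms by (auto intro: continuous_on_subset)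

section \<open>Integration of compactly supported functions on Euclidean space\<close>

text \<open>The open sets \<open>V\<close> and \<open>W - K\<close> cover \<open>W\<close>, and
  \<open>f\<close> is continuous on each, being constant on the second.\<close>

lemma continuous_on_extend_zero:
  fixes f :: "'a::t2_space \<Rightarrow> 'b::{topological_space, zero}"
  assumes "open V" "compact K" "K \<subseteq> V" "V \<subseteq> W" "open W"
    and "continuous_on V f" "\<And>x. x \<in> W - K \<Longrightarrow> f x = 0"
  shows "continuous_on W f"
proof -
  have "continuous_on (W - K) f"
    by (rule continuous_on_eq[of _ "\<lambda>_. 0"]) (use assms(7) in auto)
  moreover have "open (W - K)"
    using assms(2,5) by (simp add: compact_imp_closed open_Diff)
  ultimately have "continuous_on (V \<union> (W - K)) f"
    using assms(1,6) by (intro continuous_on_open_Un)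
  moreover have "V \<union> (W - K) = W"
    using assms(3,4) by auto
  ultimately show ?thesis
    by simp
qed

lemma set_integrable_lborel_compact:
  fixes f :: "'a::euclidean_space \<Rightarrow> real"
  assumes "compact K" "continuous_on K f"
  shows "set_integrable lborel K f"
proof -
  have "(\<lambda>x. indicator K x *\<^sub>R f x) = (\<lambda>x. if x \<in> K then f x else 0)"
    by (auto simp: indicator_def)
  then show ?thesis
    using borel_integrable_compact[OF assms] by (simp only: set_integrable_def)
qed

text \<open>A mean value estimate, used to bound difference quotients uniformly before passing to
  the limit under the integral.\<close>

lemma has_real_derivative_bound_diff:
  fixes f :: "real \<Rightarrow> real"
  assumes "\<And>t. (f has_real_derivative f' t) (at t)" "\<And>t. \<bar>f' t\<bar> \<le> M"
  shows "\<bar>f b - f a\<bar> \<le> M * \<bar>b - a\<bar>"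
  using field_differentiable_bound[of UNIV f f' M b a] assms
  by (auto intro: has_field_derivative_at_within)

text \<open>Difference quotients in direction \<open>i\<close> integrate to zero by translation invariance and
  converge boundedly to the partial derivative.\<close>

lemma set_integral_partial_deriv_eq_0:
  fixes f :: "real^'n::finite \<Rightarrow> real"
  assumes "open V" "C1_on V f" "compact K" "K \<subseteq> V" "\<And>x. x \<in> V - K \<Longrightarrow> f x = 0"
  shows "(LINT x:K|lborel. partial_deriv i f x) = 0"
proof -
  define e :: "real^'n" where "e = axis i 1"
  \<comment> \<open>Nothing is known about \<open>f\<close> outside \<open>V\<close>, so
    \<open>f\<close> and its partial derivative are replaced by globally continuous extensions by
    zero, \<open>g\<close> and \<open>d\<close>.\<close>
  define g where "g x = (if x \<in> K then f x else 0)" for x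
  define d where "d x = indicator K x * partial_deriv i f x" for x
  have opn: "open (- K)"
    using assms by (simp add: compact_imp_closed open_Compl)
  have pd0: "partial_deriv i f x = 0" if "x \<in> V - K" for x
    by (rule partial_deriv_zero[of "V - K"])
      (use that assms in \<open>auto simp: open_Diff compact_imp_closed\<close>)
  have g_V: "f x = g x" if "x \<in> V" for x
    using that assms(5) by (auto simp: g_def)
  have d_V: "partial_deriv i f x = d x" if "x \<in> V" for x
    using that pd0 by (auto simp: d_def indicator_def)
  have "continuous_on V g"
    using C1_on_imp_continuous_on[OF assms(2)] g_V by (rule continuous_on_eq)
  then have cont_g: "continuous_on UNIV g"
    by (rule continuous_on_extend_zero[OF assms(1,3,4) subset_UNIV open_UNIV]) (simp add: g_def)
  have "continuous_on V (partial_deriv i f)"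
    using assms(2) by simp
  then have "continuous_on V d"
    by (rule continuous_on_eq) (rule d_V)
  then have cont_d: "continuous_on UNIV d"
    by (rule continuous_on_extend_zero[OF assms(1,3,4) subset_UNIV open_UNIV]) (simp add: d_def)
  have der0: "((\<lambda>t. g (x + t *\<^sub>R e)) has_real_derivative d x) (at 0)" for x
  proof (cases "x \<in> V")
    case True
    then show ?thesis
      using has_real_derivative_along_axis_cong[OF has_partial_deriv[of f x i] assms(1) True g_V] assms(2)
      by (auto simp: d_V e_def)
  next
    case False
    \<comment> \<open>Outside \<open>V\<close> the point lies in the open complement of
      \<open>K\<close>, where \<open>g\<close> vanishes identically.\<close>
    then have "x \<in> - K"
      using assms(4) by auto
    then show ?thesis
      using has_real_derivative_along_axis_cong[of "\<lambda>_. 0" x i 0 "- K" g] opn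
      by (auto simp: d_def g_def e_def)
  qed
  have der: "((\<lambda>t. g (x + t *\<^sub>R e)) has_real_derivative d (x + s *\<^sub>R e)) (at s)" for x s
    using der0[of "x + s *\<^sub>R e"] DERIV_shift[of "\<lambda>t. g (x + t *\<^sub>R e)" "d (x + s *\<^sub>R e)" 0 s]
    by (simp add: algebra_simps)
  have "bounded (d ` K)"
    using assms(3) cont_d by (intro compact_imp_bounded compact_continuous_image)
      (auto intro: continuous_on_subset)
  then obtain M where M: "\<And>x. x \<in> K \<Longrightarrow> \<bar>d x\<bar> \<le> M" and M0: "M > 0"
    unfolding bounded_pos by auto
  have M': "\<bar>d x\<bar> \<le> M" for x
    using M[of x] M0 by (cases "x \<in> K") (auto simp: d_def)
  obtain R where R: "\<And>x. x \<in> K \<Longrightarrow> norm x \<le> R"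
    using compact_imp_bounded[OF assms(3)] unfolding bounded_iff by auto
  have int_g: "integrable lborel g"
  proof -
    have "set_integrable lborel K g"
      using assms(3) continuous_on_subset[OF cont_g subset_UNIV] by (rule set_integrable_lborel_compact)
    moreover have "(\<lambda>x. indicator K x *\<^sub>R g x) = g"
      by (auto simp: g_def indicator_def)
    ultimately show ?thesis
      by (simp add: set_integrable_def)
  qed
  \<comment> \<open>The step 1/(n+1) is never zero and at most 1; the second fact fixes the radius
    of the dominating ball.\<close>
  define q where "q n x = (g (x + (1 / Suc n) *\<^sub>R e) - g x) * real (Suc n)" for n :: nat and x
  have trans: "integrable lborel (\<lambda>x. g (x + c))" "(LINT x|lborel. g (x + c)) = (LINT x|lborel. g x)" for c
  proof -
    have eq: "distr lborel borel ((+) c) = lborel"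
      by (simp add: lborel_distr_plus)
    show "integrable lborel (\<lambda>x. g (x + c))"
      using integrable_distr[of "(+) c" lborel borel g] int_g by (simp add: eq add.commute)
    show "(LINT x|lborel. g (x + c)) = (LINT x|lborel. g x)"
      using integral_distr[of "(+) c" lborel borel g] int_g by (simp add: eq add.commute)
  qed
  have int_q: "(LINT x|lborel. q n x) = 0" for n
    unfolding q_def using trans int_g by simp
  have "(\<lambda>n. LINT x|lborel. q n x) \<longlonglongrightarrow> (LINT x|lborel. d x)"
  \<comment> \<open>As \<open>K\<close> lies in the ball of radius \<open>R\<close> and the shift
    has length at most 1, both \<open>x\<close> and its translate miss \<open>K\<close> once
    \<open>x\<close> is outside the ball of radius \<open>R + 1\<close>.\<close>
  proof (rule integral_dominated_convergence[where w = "\<lambda>x. M * indicator (cball 0 (R + 1)) x"])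
    show "d \<in> borel_measurable lborel"
      using cont_d by (simp add: borel_measurable_continuous_onI)
    show "q n \<in> borel_measurable lborel" for n
      unfolding q_def using trans(1) int_g by simp
    show "integrable lborel (\<lambda>x. M * indicator (cball 0 (R + 1) :: (real^'n) set) x)"
      by (intro integrable_mult_right integrable_real_indicator) 
        (auto simp: emeasure_lborel_cball_finite simp flip: infinity_ennreal_def)
    show "AE x in lborel. (\<lambda>n. q n x) \<longlonglongrightarrow> d x"
    proof (rule AE_I2)
      fix x
      have "(\<lambda>h. (g (x + h *\<^sub>R e) - g x) / h) \<midarrow>0\<rightarrow> d x"
        using der0[of x] by (simp add: DERIV_def)
      moreover have "filterlim (\<lambda>n. 1 / real (Suc n)) (at 0) sequentially"
        using LIMSEQ_inverse_real_of_nat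
        by (auto simp: filterlim_at inverse_eq_divide)
      ultimately show "(\<lambda>n. q n x) \<longlonglongrightarrow> d x"
        unfolding q_def by (auto dest: filterlim_compose)
    qed
    show "AE x in lborel. norm (q n x) \<le> M * indicator (cball 0 (R + 1)) x" for n
    proof (rule AE_I2)
      fix x
      let ?h = "1 / real (Suc n)"
      have h: "0 < ?h" "?h \<le> 1"
        by auto
      show "norm (q n x) \<le> M * indicator (cball 0 (R + 1)) x"
      proof (cases "norm x \<le> R + 1")
        case True
        have "\<bar>g (x + ?h *\<^sub>R e) - g x\<bar> \<le> M * ?h"
          using has_real_derivative_bound_diff[OF der M', of x ?h 0] h by simp
        then have "\<bar>g (x + ?h *\<^sub>R e) - g x\<bar> * real (Suc n) \<le> M * ?h * real (Suc n)"
          by (intro mult_right_mono) auto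
        then show ?thesis
          using True by (simp add: q_def abs_mult)
      next
        case False
        have "norm (?h *\<^sub>R e) \<le> 1"
          using h by (simp add: e_def)
        then have "\<not> norm (x + ?h *\<^sub>R e) \<le> R"
          using False norm_triangle_ineq4[of "x + ?h *\<^sub>R e" "?h *\<^sub>R e"]
          unfolding add_diff_cancel_right' by linarith
        then have "x \<notin> K" "x + ?h *\<^sub>R e \<notin> K"
          using R False by force+
        then show ?thesis
          using False by (simp add: q_def g_def)
      qed
    qed
  qed
  then have "(LINT x|lborel. d x) = 0"
    by (simp add: int_q LIMSEQ_const_iff)
  then show ?thesis
    by (simp add: set_lebesgue_integral_def d_def)
qed

section \<open>The hyperbolic metric and volume through the conformal factor\<close>

text \<open>The metric is the square of this factor times the Euclidean one: lengths scale by the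
  factor, volume by its N-th power.\<close>

definition conformal_factor :: "real^'n::finite \<Rightarrow> real" where
  "conformal_factor x = 2 / (1 - (norm x)\<^sup>2)"

lemma norm_sq_less_1: "x \<in> hyp \<Longrightarrow> (norm x)\<^sup>2 < 1"
  by (simp add: power_less_one_iff abs_square_less_1)

lemma conformal_factor_pos: "x \<in> hyp \<Longrightarrow> conformal_factor x > 0"
  using norm_sq_less_1[of x] by (simp add: conformal_factor_def)

lemma continuous_on_conformal_factor: "continuous_on hyp conformal_factor"
  unfolding conformal_factor_def
  by (intro continuous_intros) (use norm_sq_less_1 in force)

lemma hyp_inner_eq: "hyp_inner x v w = (conformal_factor x)\<^sup>2 * (v \<bullet> w)"
proof -
  have "mat c *v w = c *\<^sub>R w" for c :: real
    by (simp add: vec_eq_iff matrix_vector_mult_def mat_def if_distrib[of "\<lambda>z. z * _"] sum.delta cong: if_cong)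
  then show ?thesis
    by (simp add: hyp_inner_def metric_matrix_def conformal_factor_def)
qed

lemma hyp_norm_eq: "x \<in> hyp \<Longrightarrow> hyp_norm x v = conformal_factor x * norm v"
  using conformal_factor_pos[of x]
  by (simp add: hyp_norm_def hyp_inner_eq real_sqrt_mult norm_eq_sqrt_inner)

lemma hyp_grad_eq: "hyp_grad u x = (1 / (conformal_factor x)\<^sup>2) *\<^sub>R gradient u x"
  by (simp add: hyp_grad_def conformal_factor_def power_divide)

text \<open>The factor in the inner product cancels its inverse in the gradient: the pairing is the
  differential of \<open>u\<close> applied to \<open>v\<close>, independent of the metric.\<close>

lemma hyp_inner_hyp_grad: "x \<in> hyp \<Longrightarrow> hyp_inner x v (hyp_grad u x) = v \<bullet> gradient u x"
  using conformal_factor_pos[of x] by (simp add: hyp_inner_eq hyp_grad_eq)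

lemma sqrt_det_metric_matrix:
  fixes x :: "real^'n::finite"
  assumes "x \<in> hyp"
  shows "sqrt (det (metric_matrix x)) = conformal_factor x ^ CARD('n)"
proof -
  have "det (mat c :: real^'n^'n) = c ^ CARD('n)" for c
    by (subst det_diagonal) (auto simp: mat_def)
  then show ?thesis
    using conformal_factor_pos[OF assms]
    by (simp add: metric_matrix_def conformal_factor_def[symmetric] real_sqrt_power)
qed

text \<open>The value of \<open>f\<close> at the origin is arbitrary, but points are null sets.\<close>

lemma hyp_volume_integral:
  fixes f :: "real^'n::finite \<Rightarrow> real"
  assumes "supported_in K (hyp - {0}) f" "continuous_on (hyp - {0}) f"
  shows "integrable hyp_volume f" (is ?int)
    and "(\<integral>x. f x \<partial>hyp_volume) = (LINT x:K|lborel. conformal_factor x ^ CARD('n) * f x)" (is ?eq)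
proof -
  have K: "compact K" "K \<subseteq> hyp - {0}" and f0: "\<And>x. x \<in> hyp - {0} - K \<Longrightarrow> f x = 0"
    using assms by (auto simp: supported_in_def)
  let ?R = "restrict_space lborel hyp :: (real^'n) measure"
  let ?\<rho> = "\<lambda>x::real^'n. conformal_factor x ^ CARD('n)"
  have meas_f: "f \<in> borel_measurable ?R"
  proof -
    have "(\<lambda>x. indicator (hyp - {0}) x *\<^sub>R f x) \<in> borel_measurable borel"
      using borel_measurable_continuous_on_indicator[OF _ assms(2)] by simp
    \<comment> \<open>Continuity is available only off the origin; restoring the value
      \<open>f 0\<close> at that single point keeps measurability and gives a function equal to
      \<open>f\<close> on the whole ball.\<close>
    then have "(\<lambda>x. if x = 0 then f 0 else indicator (hyp - {0}) x *\<^sub>R f x) \<in> borel_measurable lborel"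
      by (intro measurable_If) (auto simp del: real_scaleR_def)
    then have "(\<lambda>x. if x = 0 then f 0 else indicator (hyp - {0}) x *\<^sub>R f x) \<in> borel_measurable ?R"
      by (rule measurable_restrict_space1)
    then show ?thesis
      by (rule measurable_cong[THEN iffD1, rotated]) (auto simp: space_restrict_space)
  qed
  have meas_\<rho>: "?\<rho> \<in> borel_measurable ?R"
  proof -
    have "continuous_on hyp ?\<rho>"
      by (intro continuous_intros continuous_on_conformal_factor)
    then have "?\<rho> \<in> borel_measurable (restrict_space borel hyp)"
      by (rule borel_measurable_continuous_on_restrict)
    then show ?thesis
      by (simp add: measurable_def sets_restrict_space space_restrict_space)
  qed
  have vol: "hyp_volume = density ?R (\<lambda>x. ennreal (?\<rho> x))"
    by (simp add: hyp_volume_def conformal_factor_def)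
  have nn: "AE x in ?R. 0 \<le> ?\<rho> x"
    by (auto intro!: AE_I2 simp: space_restrict_space less_imp_le conformal_factor_pos)
  have int_K: "set_integrable lborel K (\<lambda>x. ?\<rho> x * f x)"
  proof -
    have "continuous_on K (\<lambda>x. ?\<rho> x * f x)"
      using K assms(2) continuous_on_conformal_factor
      by (intro continuous_intros) (auto intro: continuous_on_subset)
    then show ?thesis
      by (rule set_integrable_lborel_compact[OF K(1)])
  qed
  have meas2: "(\<lambda>x. indicator hyp x *\<^sub>R (?\<rho> x * f x)) \<in> borel_measurable lborel"
    using borel_measurable_times[OF meas_\<rho> meas_f]
    by (subst (asm) borel_measurable_restrict_space_iff) auto
  have meas3: "(\<lambda>x. indicator K x *\<^sub>R (?\<rho> x * f x)) \<in> borel_measurable lborel"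
    using int_K by (simp add: set_integrable_def)
  \<comment> \<open>The two integrands can differ only at the origin, where \<open>f\<close> need
    not vanish although the origin is not in \<open>K\<close>.\<close>
  have ae: "AE x in lborel. indicator hyp x *\<^sub>R (?\<rho> x * f x) = indicator K x *\<^sub>R (?\<rho> x * f x)"
    using AE_lborel_singleton[of "0 :: real^'n"]
  proof eventually_elim
    case (elim x)
    then show ?case
      using f0[of x] K(2) by (auto simp: indicator_def)
  qed
  have "integrable lborel (\<lambda>x. indicator hyp x *\<^sub>R (?\<rho> x * f x))"
    using int_K integrable_cong_AE[OF meas2 meas3 ae] by (simp add: set_integrable_def)
  then have "integrable ?R (\<lambda>x. ?\<rho> x * f x)"
    by (subst integrable_restrict_space) auto
  then show ?int
    using integrable_real_density[OF meas_\<rho> nn meas_f] by (simp add: vol)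
  have "(\<integral>x. f x \<partial>hyp_volume) = (\<integral>x. ?\<rho> x * f x \<partial>?R)"
    using integral_real_density[OF meas_\<rho> nn meas_f] by (simp add: vol)
  also have "\<dots> = (\<integral>x. indicator hyp x *\<^sub>R (?\<rho> x * f x) \<partial>lborel)"
    by (subst integral_restrict_space) (auto simp: set_lebesgue_integral_def)
  also have "\<dots> = (LINT x:K|lborel. ?\<rho> x * f x)"
    using integral_cong_AE[OF meas2 meas3 ae] by (simp add: set_lebesgue_integral_def)
  finally show ?eq .
qed

section \<open>C^1 regularity of the volume density\<close>

lemma C1_on_cong:
  assumes "open S" "C1_on S f" "\<And>x. x \<in> S \<Longrightarrow> f x = g x"
  shows "C1_on S g"
    and "x \<in> S \<Longrightarrow> partial_deriv i g x = partial_deriv i f x"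
proof -
  have pd: "partial_deriv i g x = partial_deriv i f x" if "x \<in> S" for i x
    by (rule partial_deriv_eqI,
        rule has_real_derivative_along_axis_cong[OF has_partial_deriv assms(1) that assms(3)])
      (use assms(2) that in auto)
  then show "x \<in> S \<Longrightarrow> partial_deriv i g x = partial_deriv i f x" .
  have "g differentiable (at x)" if "x \<in> S" for x
    using assms that unfolding C1_on_iff differentiable_def
    by (blast intro: has_derivative_transform_within_open)
  moreover have "continuous_on S (partial_deriv i g)" for i
    by (rule continuous_on_eq[of _ "partial_deriv i f"]) (use assms(2) pd in auto)
  ultimately show "C1_on S g"
    by simp
qed

lemma partial_deriv_conformal_factor:
  assumes "x \<in> hyp"
  shows "partial_deriv i conformal_factor x = (conformal_factor x)\<^sup>2 * x $ i"
proof (rule partial_deriv_eqI)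
  have "(norm (x + t *\<^sub>R axis i 1))\<^sup>2 = (norm x)\<^sup>2 + 2 * t * x $ i + t\<^sup>2" for t
    by (simp add: power2_norm_eq_inner inner_add_left inner_add_right inner_axis inner_axis'
        algebra_simps) (simp add: power2_eq_square)
  then have eq: "conformal_factor (x + t *\<^sub>R axis i 1) = 2 / (1 - ((norm x)\<^sup>2 + 2 * t * x $ i + t\<^sup>2))" for t
    by (simp add: conformal_factor_def)
  show "((\<lambda>t. conformal_factor (x + t *\<^sub>R axis i 1)) has_real_derivative
      (conformal_factor x)\<^sup>2 * x $ i) (at 0)"
    unfolding eq using norm_sq_less_1[OF assms]
    by (auto intro!: derivative_eq_intros simp: conformal_factor_def power_divide power2_eq_square)
qed

lemma C1_on_conformal_factor: "C1_on hyp conformal_factor"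
proof -
  have "conformal_factor differentiable (at x)" if "x \<in> hyp" for x :: "real^'n"
  proof -
    \<comment> \<open>With the squared norm as an inner product this is differentiable at the origin
      too, where \<open>norm\<close> itself is not.\<close>
    have eq: "conformal_factor = (\<lambda>x::real^'n. 2 / (1 - x \<bullet> x))"
      by (simp add: conformal_factor_def fun_eq_iff power2_norm_eq_inner)
    have "1 - x \<bullet> x \<noteq> 0"
      using norm_sq_less_1[OF that] by (simp add: power2_norm_eq_inner)
    then show ?thesis
      unfolding eq by (auto intro!: derivative_intros)
  qed
  moreover have "continuous_on hyp (partial_deriv i (conformal_factor :: real^'n \<Rightarrow> real))" for i
    by (rule continuous_on_eq[of _ "\<lambda>x. (conformal_factor x)\<^sup>2 * x $ i"])
      (auto intro!: continuous_intros continuous_on_conformal_factor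
        simp: partial_deriv_conformal_factor simp del: mem_ball)
  ultimately show ?thesis
    unfolding C1_on_iff by blast
qed

lemma C1_on_const: "C1_on S (\<lambda>_. c)"
proof -
  have "partial_deriv i (\<lambda>_. c) = (\<lambda>_. 0)" for i :: "'a"
    by (rule ext, rule partial_deriv_eqI) simp
  then show ?thesis
    by simp
qed

lemma C1_on_power: "C1_on S f \<Longrightarrow> C1_on S (\<lambda>x. f x ^ m)"
proof (induction m)
  case 0
  show ?case
    using C1_on_const[of S 1] by simp
next
  case (Suc m)
  show ?case
    using C1_on_mult[OF Suc.prems Suc.IH[OF Suc.prems]] by (simp only: power_Suc)
qed

section \<open>Regularity of p-th powers for p > 1\<close>

text \<open>Away from 0 this is the usual power rule on each side. At 0 the difference quotient has
  modulus |h|^(p-1), which tends to 0 because p > 1, and the claimed derivative is 0 as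
  well.\<close>

lemma has_real_derivative_abs_powr:
  fixes p t :: real
  assumes "p > 1"
  shows "((\<lambda>t. \<bar>t\<bar> powr p) has_real_derivative p * (\<bar>t\<bar> powr (p - 2) * t)) (at t)"
proof (cases t "0 :: real" rule: linorder_cases)
  case less
  have "((\<lambda>t. (- t) powr p) has_real_derivative p * (\<bar>t\<bar> powr (p - 2) * t)) (at t)"
    using less powr_add[of "- t" "p - 2" 1]
    by (auto intro!: derivative_eq_intros simp: powr_diff field_simps)
  then show ?thesis
    by (rule has_field_derivative_transform_within_open[of _ _ _ "{..<0}"]) (use less in auto)
next
  case greater
  have "((\<lambda>t. t powr p) has_real_derivative p * (\<bar>t\<bar> powr (p - 2) * t)) (at t)"
    using greater powr_add[of t "p - 2" 1]
    by (auto intro!: derivative_eq_intros simp: powr_diff field_simps)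
  then show ?thesis
    by (rule has_field_derivative_transform_within_open[of _ _ _ "{0<..}"]) (use greater in auto)
next
  case equal
  have "((\<lambda>h::real. \<bar>h\<bar> powr (p - 1)) \<longlongrightarrow> \<bar>0\<bar> powr (p - 1)) (at 0)"
    using assms by (intro tendsto_powr' tendsto_intros) auto
  then have "((\<lambda>h::real. \<bar>h\<bar> powr (p - 1)) \<longlongrightarrow> 0) (at 0)"
    using assms by simp
  moreover have "\<bar>\<bar>h\<bar> powr p / h\<bar> = \<bar>h\<bar> powr (p - 1)" for h :: real
    using powr_diff[of "\<bar>h\<bar>" p 1] by simp
  ultimately have "((\<lambda>h::real. \<bar>\<bar>h\<bar> powr p / h\<bar>) \<longlongrightarrow> 0) (at 0)"
    by (simp only:)
  then have "(\<lambda>h::real. \<bar>h\<bar> powr p / h) \<midarrow>0\<rightarrow> 0"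
    by (rule tendsto_rabs_zero_cancel)
  then show ?thesis
    using equal assms by (simp add: DERIV_def)
qed

text \<open>The map v |-> |v|^(p-2) v has norm |v|^(p-1), so it is continuous at 0 even if p < 2. It
  is needed both for the scalar \<open>u\<close> and for the field \<open>X\<close>.\<close>

lemma continuous_on_norm_powr_scaleR:
  fixes f :: "'a::topological_space \<Rightarrow> 'b::real_normed_vector"
  assumes "p > 1" "continuous_on S f"
  shows "continuous_on S (\<lambda>x. norm (f x) powr (p - 2) *\<^sub>R f x)"
proof -
  have "isCont (\<lambda>v::'b. norm v powr (p - 2) *\<^sub>R v) v" for v
  proof (cases "v = 0")
    case True
    have eq: "norm (norm v powr (p - 2) *\<^sub>R v) = norm v powr (p - 1)" for v :: 'b
      using powr_add[of "norm v" "p - 2" 1] by simp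
    have "((\<lambda>v::'b. norm v powr (p - 1)) \<longlongrightarrow> norm (0::'b) powr (p - 1)) (at 0)"
      using assms by (intro tendsto_powr' tendsto_intros) auto
    then have "((\<lambda>v::'b. norm (norm v powr (p - 2) *\<^sub>R v)) \<longlongrightarrow> 0) (at 0)"
      using assms unfolding eq by simp
    then have "((\<lambda>v::'b. norm v powr (p - 2) *\<^sub>R v) \<longlongrightarrow> 0) (at 0)"
      by (rule tendsto_norm_zero_cancel)
    then show ?thesis
      using True by (simp add: isCont_def)
  next
    case False
    then show ?thesis
      unfolding isCont_def by (intro tendsto_intros) simp
  qed
  then have "continuous_on UNIV (\<lambda>v::'b. norm v powr (p - 2) *\<^sub>R v)"
    by (simp add: continuous_at_imp_continuous_on)
  from continuous_on_compose2[OF this assms(2)] show ?thesis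
    by simp
qed

text \<open>Continuity of the partial derivatives rests on |t|^(p-2) t as a whole, since |t|^(p-2)
  is unbounded near 0 when p < 2.\<close>

lemma C1_on_abs_powr:
  assumes "p > 1" "C1_on S u"
  shows "C1_on S (\<lambda>x. \<bar>u x\<bar> powr p)"
    and "x \<in> S \<Longrightarrow> partial_deriv i (\<lambda>x. \<bar>u x\<bar> powr p) x
      = p * (\<bar>u x\<bar> powr (p - 2) * u x) * partial_deriv i u x"
proof -
  have pd: "partial_deriv i (\<lambda>x. \<bar>u x\<bar> powr p) x
      = p * (\<bar>u x\<bar> powr (p - 2) * u x) * partial_deriv i u x" if "x \<in> S" for i x
    by (rule partial_deriv_eqI)
      (use DERIV_chain2[of "\<lambda>t. \<bar>t\<bar> powr p", OF _ has_partial_deriv[of u x i]]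
        has_real_derivative_abs_powr[OF assms(1), of "u x"] assms(2) that in auto)
  then show "x \<in> S \<Longrightarrow> partial_deriv i (\<lambda>x. \<bar>u x\<bar> powr p) x
      = p * (\<bar>u x\<bar> powr (p - 2) * u x) * partial_deriv i u x" .
  have "(\<lambda>x. \<bar>u x\<bar> powr p) differentiable (at x)" if "x \<in> S" for x
  proof -
    have "(\<lambda>t. \<bar>t\<bar> powr p) differentiable (at (u x))"
      using has_real_derivative_abs_powr[OF assms(1), of "u x"]
      by (auto simp: real_differentiable_def)
    then have "((\<lambda>t. \<bar>t\<bar> powr p) \<circ> u) differentiable (at x)"
      using assms(2) that by (intro differentiable_chain_at) auto
    then show ?thesis
      by (simp add: o_def)
  qed
  moreover have "continuous_on S (partial_deriv i (\<lambda>x. \<bar>u x\<bar> powr p))" for i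
  proof (rule continuous_on_eq)
    have "continuous_on S (\<lambda>x. \<bar>u x\<bar> powr (p - 2) * u x)"
      using continuous_on_norm_powr_scaleR[OF assms(1) C1_on_imp_continuous_on[OF assms(2)]] by simp
    moreover have "continuous_on S (partial_deriv i u)"
      using assms(2) by simp
    ultimately show "continuous_on S (\<lambda>x. p * (\<bar>u x\<bar> powr (p - 2) * u x) * partial_deriv i u x)"
      by (rule continuous_on_mult[OF continuous_on_mult[OF continuous_on_const]])
  qed (simp add: pd)
  ultimately show "C1_on S (\<lambda>x. \<bar>u x\<bar> powr p)"
    by simp
qed

section \<open>Integration by parts and the weak divergence\<close>

lemma gradient_eq_0:
  assumes "supported_in K S u" "open S" "x \<in> S - K"
  shows "gradient u x = 0"
proof -
  have "partial_deriv i u x = 0" for i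
    by (rule partial_deriv_zero[of "S - K"])
      (use assms in \<open>auto simp: supported_in_def compact_imp_closed open_Diff\<close>)
  then show ?thesis
    by (simp add: gradient_def vec_eq_iff)
qed

lemma continuous_on_gradient:
  assumes "C1_on S u"
  shows "continuous_on S (gradient u)"
  unfolding gradient_def using assms by (intro continuous_on_vec_lambda) auto

text \<open>Multiplied by the volume density, the two integrands add up to the Euclidean divergence
  of the field with components Y^i times density times w. Each partial derivative in it has integral
  zero.\<close>

lemma integral_hyp_div_mult:
  fixes w :: "real^'n::finite \<Rightarrow> real"
  assumes V: "open V" "V \<subseteq> hyp - {0}" "K \<subseteq> V"
    and Y: "C1_vector_field_on V Y"
    and w: "C1_on (hyp - {0}) w" "supported_in K (hyp - {0}) w"
  shows "(\<integral>x. hyp_div Y x * w x \<partial>hyp_volume)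
    = - (\<integral>x. hyp_inner x (Y x) (hyp_grad w x) \<partial>hyp_volume)"
proof -
  let ?\<rho> = "\<lambda>x::real^'n. conformal_factor x ^ CARD('n)"
  let ?h = "\<lambda>i y. Y y $ i * sqrt (det (metric_matrix y))"
  let ?D = "\<lambda>x. hyp_div Y x * w x"
  let ?G = "\<lambda>x. hyp_inner x (Y x) (hyp_grad w x)"
  have W: "open (hyp - {0} :: (real^'n) set)"
    by (simp add: open_Diff)
  have K: "compact K" "\<And>x. x \<in> hyp - {0} - K \<Longrightarrow> w x = 0"
    using w(2) by (auto simp: supported_in_def)
  have V_hyp: "x \<in> hyp" if "x \<in> V" for x
    using V(2) that by auto
  have sqrt_det: "sqrt (det (metric_matrix x)) = ?\<rho> x" if "x \<in> V" for x
    using V_hyp[OF that] by (rule sqrt_det_metric_matrix)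
  have inner_grad: "hyp_inner x v (hyp_grad w x) = v \<bullet> gradient w x" if "x \<in> V" for x v
    using V_hyp[OF that] by (rule hyp_inner_hyp_grad)
  have wV: "C1_on V w"
    using C1_on_subset[OF w(1) V(2)] .
  have \<rho>V: "C1_on V ?\<rho>"
    by (rule C1_on_subset[OF C1_on_power[OF C1_on_conformal_factor]]) (use V_hyp in auto)
  have hV: "C1_on V (?h i)" for i
  proof (rule C1_on_cong(1)[OF V(1)])
    show "C1_on V (\<lambda>x. Y x $ i * ?\<rho> x)"
      using Y by (intro C1_on_mult \<rho>V) (simp add: C1_vector_field_on_def)
  qed (simp add: sqrt_det)
  have \<rho>_pos: "?\<rho> x > 0" if "x \<in> V" for x
    using V_hyp[OF that] by (simp add: conformal_factor_pos)
  have D_eq: "?\<rho> x * ?D x = (\<Sum>i\<in>UNIV. partial_deriv i (?h i) x * w x)" if "x \<in> V" for x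
    using conformal_factor_pos[OF V_hyp[OF that]]
    by (simp add: hyp_div_def sqrt_det[OF that] sum_distrib_right)
  have G_eq: "?\<rho> x * ?G x = (\<Sum>i\<in>UNIV. ?h i x * partial_deriv i w x)" if "x \<in> V" for x
    by (simp add: inner_grad[OF that] sqrt_det[OF that] inner_vec_def gradient_def
        sum_distrib_left mult_ac)
  have cont_pd: "continuous_on V (partial_deriv i f)" if "C1_on V f" for i f
    using that by simp
  have cont_sum: "continuous_on V (\<lambda>x. \<Sum>i\<in>UNIV. partial_deriv i (?h i) x * w x)"
    "continuous_on V (\<lambda>x. \<Sum>i\<in>UNIV. ?h i x * partial_deriv i w x)"
    by (intro continuous_on_sum continuous_on_mult[OF cont_pd[OF hV] C1_on_imp_continuous_on[OF wV]])
      (intro continuous_on_sum continuous_on_mult[OF C1_on_imp_continuous_on[OF hV] cont_pd[OF wV]])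
  \<comment> \<open>Both integrands are known to be continuous after multiplication by the density
    \<open>?\<rho>\<close>, which is positive and can be divided out.\<close>
  have cont_div: "continuous_on V F"
    if "continuous_on V (\<lambda>x. ?\<rho> x * F x)" for F :: "real^'n \<Rightarrow> real"
  proof (rule continuous_on_eq)
    show "continuous_on V (\<lambda>x. ?\<rho> x * F x / ?\<rho> x)"
      using \<rho>_pos by (intro continuous_on_divide that C1_on_imp_continuous_on[OF \<rho>V])
        (blast dest: less_imp_neq[symmetric])
    show "?\<rho> x * F x / ?\<rho> x = F x" if "x \<in> V" for x
      using \<rho>_pos[OF that] by (intro nonzero_mult_div_cancel_left less_imp_neq[symmetric])
  qed
  have contV: "continuous_on V ?D" "continuous_on V ?G"
    by (rule cont_div, rule continuous_on_eq[OF cont_sum(1)], simp only: D_eq)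
      (rule cont_div, rule continuous_on_eq[OF cont_sum(2)], simp only: G_eq)
  have D0: "?D x = 0" and G0: "?G x = 0" if "x \<in> hyp - {0} - K" for x
    using K(2)[OF that] gradient_eq_0[OF w(2) W that] by (simp_all add: hyp_grad_eq hyp_inner_eq)
  have supp: "supported_in K (hyp - {0}) ?D" "supported_in K (hyp - {0}) ?G"
    using w(2) D0 G0 by (simp_all add: supported_in_def)
  \<comment> \<open>\<open>Y\<close> is controlled only on \<open>V\<close>, but both integrands
    vanish off \<open>K\<close>, so continuity extends to the whole punctured ball.\<close>
  have cont: "continuous_on (hyp - {0}) ?D" "continuous_on (hyp - {0}) ?G"
    using continuous_on_extend_zero[OF V(1) K(1) V(3) V(2) W contV(1) D0]
      continuous_on_extend_zero[OF V(1) K(1) V(3) V(2) W contV(2) G0] by auto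
  have int_K: "set_integrable lborel K F" if "continuous_on V F" for F :: "real^'n \<Rightarrow> real"
    using K(1) continuous_on_subset[OF that V(3)] by (rule set_integrable_lborel_compact)
  have intD: "set_integrable lborel K (\<lambda>x. ?\<rho> x * ?D x)"
    and intG: "set_integrable lborel K (\<lambda>x. ?\<rho> x * ?G x)"
    by (intro int_K continuous_on_mult contV C1_on_imp_continuous_on[OF \<rho>V])+
  have hwV: "C1_on V (\<lambda>x. ?h i x * w x)" for i
    by (intro C1_on_mult hV wV)
  have K_sets: "K \<in> sets lborel"
    using K(1) by (simp add: borel_compact)
  have "(\<integral>x. ?D x \<partial>hyp_volume) + (\<integral>x. ?G x \<partial>hyp_volume)
      = (LINT x:K|lborel. ?\<rho> x * ?D x + ?\<rho> x * ?G x)"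
    unfolding hyp_volume_integral(2)[OF supp(1) cont(1)] hyp_volume_integral(2)[OF supp(2) cont(2)]
    by (rule set_integral_add(2)[OF intD intG, symmetric])
  also have "\<dots> = (LINT x:K|lborel. \<Sum>i\<in>UNIV. partial_deriv i (\<lambda>x. ?h i x * w x) x)"
  proof (rule set_lebesgue_integral_cong[OF K_sets], intro allI impI)
    fix x assume "x \<in> K"
    then have x: "x \<in> V"
      using V(3) by auto
    have "partial_deriv i (\<lambda>x. ?h i x * w x) x
        = partial_deriv i (?h i) x * w x + ?h i x * partial_deriv i w x" for i
      using hV[of i] wV x by (intro partial_deriv_mult) (simp_all only: C1_on_iff)
    then show "?\<rho> x * ?D x + ?\<rho> x * ?G x = (\<Sum>i\<in>UNIV. partial_deriv i (\<lambda>x. ?h i x * w x) x)"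
      unfolding D_eq[OF x] G_eq[OF x] by (simp only: sum.distrib)
  qed
  also have "\<dots> = (\<Sum>i\<in>UNIV. LINT x:K|lborel. partial_deriv i (\<lambda>x. ?h i x * w x) x)"
    unfolding set_lebesgue_integral_def scaleR_sum_right
  proof (rule Bochner_Integration.integral_sum)
    fix i :: 'n
    show "integrable lborel (\<lambda>x. indicator K x *\<^sub>R partial_deriv i (\<lambda>x. ?h i x * w x) x)"
      using int_K[of "partial_deriv i (\<lambda>x. ?h i x * w x)"] hwV[of i]
      unfolding C1_on_iff set_integrable_def by blast
  qed
  also have "\<dots> = 0"
    by (intro sum.neutral ballI set_integral_partial_deriv_eq_0[OF V(1) hwV K(1) V(3)])
      (use K(2) V(2) in force)
  finally show ?thesis
    by simp
qed

text \<open>The two branches of \<open>div_integral\<close> agree for C^1 \<open>w\<close>, so no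
  case distinction on the regularity of \<open>Y\<close> is needed afterwards.\<close>

lemma div_integral_eq:
  assumes "C1_on (hyp - {0}) w"
  shows "div_integral Y w = - (\<integral>x. hyp_inner x (Y x) (hyp_grad w x) \<partial>hyp_volume)"
proof (cases "\<exists>U K. open U \<and> K \<subseteq> U \<and> supported_in K (hyp - {0}) w \<and> C1_vector_field_on U Y")
  case True
  then obtain U K where U: "open U" "K \<subseteq> U" "supported_in K (hyp - {0}) w" "C1_vector_field_on U Y"
    by blast
  have "div_integral Y w = (\<integral>x. hyp_div Y x * w x \<partial>hyp_volume)"
    using True by (simp add: div_integral_def)
  also have "\<dots> = - (\<integral>x. hyp_inner x (Y x) (hyp_grad w x) \<partial>hyp_volume)"
  \<comment> \<open>\<open>U\<close> may contain the origin or leave the ball, where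
    \<open>w\<close> is not controlled; the intersection still contains \<open>K\<close>.\<close>
  proof (rule integral_hyp_div_mult[of "U \<inter> (hyp - {0})"])
    show "C1_vector_field_on (U \<inter> (hyp - {0})) Y"
      using U(4) C1_on_subset[of U _ "U \<inter> (hyp - {0})"] unfolding C1_vector_field_on_def by blast
  qed (use U assms in \<open>auto simp: supported_in_def open_Int open_Diff\<close>)
  finally show ?thesis .
next
  case False
  then show ?thesis
    by (simp only: div_integral_def if_False)
qed

section \<open>Scaling in the remainder and the final identity\<close>

lemma hyp_norm_scaleR: "x \<in> hyp \<Longrightarrow> hyp_norm x (c *\<^sub>R v) = \<bar>c\<bar> * hyp_norm x v"
  by (simp add: hyp_norm_eq del: mem_ball)

lemma hyp_norm_nonneg: "x \<in> hyp \<Longrightarrow> hyp_norm x v \<ge> 0"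
  using conformal_factor_pos[of x] by (simp add: hyp_norm_eq del: mem_ball)

text \<open>With a = \<open>lam powr (1 / (p - 1))\<close>, the mixed term carries
  \<open>lam\<close> from the second argument and a^(-(p-1)) from the first. The exponent is chosen
  so that a^(p-1) = \<open>lam\<close>.\<close>

lemma R_p_scaleR:
  assumes "p > 1" "lam > 0" "x \<in> hyp"
  shows "R_p p x ((c / lam powr (1 / (p - 1))) *\<^sub>R v) (lam *\<^sub>R w)
    = lam powr p * hyp_norm x w powr p
      + (p - 1) / lam powr (p / (p - 1)) * hyp_norm x (c *\<^sub>R v) powr p
      - p * (\<bar>c\<bar> powr (p - 2) * c) * hyp_norm x v powr (p - 2) * hyp_inner x v w"
proof -
  define a where "a = lam powr (1 / (p - 1))"
  have a: "a > 0" "a powr p = lam powr (p / (p - 1))" "a powr (p - 2) * a = lam"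
  proof -
    show "a > 0"
      using assms by (simp add: a_def)
    then have "a powr (p - 2) * a = a powr (p - 1)"
      using powr_add[of a "p - 2" 1] by simp
    then show "a powr (p - 2) * a = lam"
      using assms by (simp add: a_def powr_powr)
  qed (simp add: a_def powr_powr)
  have inner: "hyp_inner x ((c / a) *\<^sub>R v) (lam *\<^sub>R w) = c / a * lam * hyp_inner x v w"
    by (simp add: hyp_inner_eq)
  have n: "hyp_norm x ((c / a) *\<^sub>R v) powr q = \<bar>c\<bar> powr q / a powr q * hyp_norm x v powr q" for q
    using a(1) hyp_norm_nonneg[OF assms(3)] assms(3)
    by (simp add: hyp_norm_scaleR powr_mult powr_divide del: mem_ball)
  have "\<bar>c\<bar> powr (p - 2) / a powr (p - 2) * (c / a * lam) = \<bar>c\<bar> powr (p - 2) * c * (lam / (a powr (p - 2) * a))"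
    by simp
  also have "\<dots> = \<bar>c\<bar> powr (p - 2) * c"
    using a(3) assms(2) by simp
  finally have cross: "\<bar>c\<bar> powr (p - 2) / a powr (p - 2) * (c / a * lam) = \<bar>c\<bar> powr (p - 2) * c" .
  have "p * (\<bar>c\<bar> powr (p - 2) / a powr (p - 2) * hyp_norm x v powr (p - 2)) * (c / a * lam * hyp_inner x v w)
     = p * (\<bar>c\<bar> powr (p - 2) / a powr (p - 2) * (c / a * lam)) * hyp_norm x v powr (p - 2) * hyp_inner x v w"
    by (simp only: mult_ac)
  also have "\<dots> = p * (\<bar>c\<bar> powr (p - 2) * c) * hyp_norm x v powr (p - 2) * hyp_inner x v w"
    unfolding cross ..
  finally show ?thesis
    using assms hyp_norm_nonneg[OF assms(3)]
    unfolding R_p_def a_def[symmetric] inner n a(2)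
    by (simp add: hyp_norm_scaleR powr_mult del: mem_ball)
qed

theorem theorem1p1:
  fixes p lam :: real
    and A u :: "real^'n::finite \<Rightarrow> real"
    and X :: "real^'n \<Rightarrow> real^'n"
  assumes "p > 1" and "lam > 0"
    and "C1_on (hyp - {0}) A"
    and "smooth_vector_field_on hyp X"
    and "u \<in> C1_0 (hyp - {0})"
  shows "lam powr p * (\<integral>x. A x * hyp_norm x (hyp_grad u x) powr p \<partial>hyp_volume)
      + (p - 1) / lam powr (p / (p - 1)) *
          (\<integral>x. A x * hyp_norm x (u x *\<^sub>R X x) powr p \<partial>hyp_volume)
    = - div_integral (\<lambda>x. (A x * hyp_norm x (X x) powr (p - 2)) *\<^sub>R X x) (\<lambda>x. \<bar>u x\<bar> powr p)
      + (\<integral>x. A x * R_p p x ((u x / lam powr (1 / (p - 1))) *\<^sub>R X x) (lam *\<^sub>R hyp_grad u x)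
          \<partial>hyp_volume)"
proof -
  note p = assms(1) and A = assms(3) and X = assms(4)
  define W where "W = (hyp - {0} :: (real^'n) set)"
  have W: "open W" "W \<subseteq> hyp"
    by (auto simp: W_def open_Diff)
  have u: "C1_on W u"
    using assms(5) by (simp add: C1_0_def W_def)
  obtain K where K: "supported_in K W u"
    using assms(5) by (auto simp: C1_0_def W_def)
  have u0: "u x = 0" "gradient u x = 0" if "x \<in> W - K" for x
    using K that gradient_eq_0[OF K W(1) that] by (auto simp: supported_in_def)
  \<comment> \<open>Up to the factor \<open>p\<close>, the derivative of |t|^p at
    \<open>u x\<close>.\<close>
  let ?\<sigma> = "\<lambda>x. \<bar>u x\<bar> powr (p - 2) * u x"
  let ?w = "\<lambda>x. \<bar>u x\<bar> powr p"
  let ?Y = "\<lambda>x. (A x * hyp_norm x (X x) powr (p - 2)) *\<^sub>R X x"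
  let ?F1 = "\<lambda>x. A x * hyp_norm x (hyp_grad u x) powr p"
  let ?F2 = "\<lambda>x. A x * hyp_norm x (u x *\<^sub>R X x) powr p"
  \<comment> \<open>The mixed term of A times the expanded remainder; it is to be matched with
    \<open>?G\<close>, the weak divergence integrand tested against |u|^p.\<close>
  let ?E = "\<lambda>x. A x * (p * ?\<sigma> x * hyp_norm x (X x) powr (p - 2) * hyp_inner x (X x) (hyp_grad u x))"
  let ?G = "\<lambda>x. hyp_inner x (?Y x) (hyp_grad ?w x)"
  have cont_u: "continuous_on W u" and cont_gu: "continuous_on W (gradient u)"
    using u by (rule C1_on_imp_continuous_on, rule continuous_on_gradient)
  have cont_A: "continuous_on W A"
    using A by (intro C1_on_imp_continuous_on) (simp add: W_def)
  have cont_c: "continuous_on W conformal_factor"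
    using continuous_on_conformal_factor W(2) by (rule continuous_on_subset)
  have c_pos: "conformal_factor x > 0" if "x \<in> W" for x
    using that W(2) conformal_factor_pos by blast
  have "continuous_on hyp (\<lambda>x. X x $ i)" for i
    using X unfolding smooth_vector_field_on_def by (metis Ck_on.simps(1))
  then have "continuous_on hyp (\<lambda>x. \<chi> i. X x $ i)"
    by (intro continuous_on_vec_lambda)
  then have cont_X: "continuous_on W X"
    using W(2) by (auto intro: continuous_on_subset)
  have cont1: "continuous_on W ?F1"
  proof (rule continuous_on_eq)
    show "continuous_on W (\<lambda>x. A x * (conformal_factor x * norm ((1 / (conformal_factor x)\<^sup>2) *\<^sub>R gradient u x)) powr p)"
      using p c_pos
      by (intro continuous_on_mult continuous_on_powr' continuous_on_norm continuous_on_scaleR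
          continuous_on_divide continuous_on_power continuous_on_const cont_A cont_c cont_gu)
        (force simp: less_imp_le)+
  qed (use W(2) in \<open>simp add: hyp_norm_eq hyp_grad_eq subset_eq del: mem_ball\<close>)
  have cont2: "continuous_on W ?F2"
  proof (rule continuous_on_eq)
    show "continuous_on W (\<lambda>x. A x * (conformal_factor x * norm (u x *\<^sub>R X x)) powr p)"
      using p c_pos
      by (intro continuous_on_mult continuous_on_powr' continuous_on_norm continuous_on_scaleR
          continuous_on_const cont_A cont_c cont_u cont_X)
        (force simp: less_imp_le)+
  qed (use W(2) in \<open>simp add: hyp_norm_eq subset_eq del: mem_ball\<close>)
  have contE: "continuous_on W ?E"
  proof (rule continuous_on_eq)
    \<comment> \<open>For p < 2 the power of \<open>hyp_norm\<close> alone may be discontinuous at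
      zeros of \<open>X\<close>. It is split into a power of the positive conformal factor and a
      Euclidean part that stays attached to \<open>X\<close>.\<close>
    have cont_cp: "continuous_on W (\<lambda>x. conformal_factor x powr (p - 2))"
      using c_pos by (intro continuous_on_powr continuous_on_const cont_c) force
    have "continuous_on W ?\<sigma>"
      using continuous_on_norm_powr_scaleR[OF p cont_u] by simp
    then show "continuous_on W (\<lambda>x. A x * (p * ?\<sigma> x * conformal_factor x powr (p - 2)
        * ((norm (X x) powr (p - 2) *\<^sub>R X x) \<bullet> gradient u x)))"
      using cont_cp continuous_on_norm_powr_scaleR[OF p cont_X]
      by (intro continuous_on_mult[OF cont_A] continuous_on_mult[OF continuous_on_mult]
          continuous_on_mult[OF continuous_on_const] continuous_on_inner cont_gu)
    fix x assume "x \<in> W"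
    then have "x \<in> hyp" "conformal_factor x \<ge> 0"
      using W(2) c_pos[of x] by auto
    then show "A x * (p * ?\<sigma> x * conformal_factor x powr (p - 2)
        * ((norm (X x) powr (p - 2) *\<^sub>R X x) \<bullet> gradient u x)) = ?E x"
      by (simp add: hyp_inner_hyp_grad hyp_norm_eq powr_mult del: mem_ball)
  qed
  have GE: "?G x = ?E x" if "x \<in> W" for x
  proof -
    have "gradient ?w x = (p * ?\<sigma> x) *\<^sub>R gradient u x"
      using C1_on_abs_powr(2)[OF p u that] by (simp add: gradient_def vec_eq_iff)
    moreover have "x \<in> hyp"
      using that W(2) by auto
    ultimately show ?thesis
      by (simp add: hyp_inner_hyp_grad del: mem_ball)
  qed
  have contG: "continuous_on W ?G"
    by (rule continuous_on_eq[OF contE]) (rule GE[symmetric])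
  have supp: "supported_in K W ?F1" "supported_in K W ?F2" "supported_in K W ?E"
    using K u0 by (simp_all add: supported_in_def hyp_norm_def hyp_inner_eq hyp_grad_eq)
  have suppG: "supported_in K W ?G"
    using supp(3) GE unfolding supported_in_def by (metis DiffD1)
  have K_sets: "K \<in> sets lborel" "K \<subseteq> W"
    using K by (simp_all add: supported_in_def borel_compact)
  note vol = hyp_volume_integral[of K, folded W_def]
  \<comment> \<open>\<open>GE\<close> holds only off the origin, so the integrals are compared after
    reduction to \<open>K\<close>.\<close>
  have "(\<integral>x. ?G x \<partial>hyp_volume) = (\<integral>x. ?E x \<partial>hyp_volume)"
    unfolding vol(2)[OF suppG contG] vol(2)[OF supp(3) contE]
  proof (rule set_lebesgue_integral_cong[OF K_sets(1)], intro allI impI)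
    fix x assume "x \<in> K"
    then have "?G x = ?E x"
      using K_sets(2) by (intro GE) (rule subsetD)
    then show "conformal_factor x ^ CARD('n) * ?G x = conformal_factor x ^ CARD('n) * ?E x"
      by (rule arg_cong)
  qed
  then have div: "div_integral ?Y ?w = - (\<integral>x. ?E x \<partial>hyp_volume)"
    using div_integral_eq[OF C1_on_abs_powr(1)[OF p u, unfolded W_def]] by simp
  let ?c1 = "lam powr p" and ?c2 = "(p - 1) / lam powr (p / (p - 1))"
  have "(\<integral>x. A x * R_p p x ((u x / lam powr (1 / (p - 1))) *\<^sub>R X x) (lam *\<^sub>R hyp_grad u x) \<partial>hyp_volume)
      = (\<integral>x. ?c1 * ?F1 x + ?c2 * ?F2 x - ?E x \<partial>hyp_volume)"
  \<comment> \<open>The expansion of the remainder holds at every point of the ball, the origin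
    included, so no null set has to be removed.\<close>
  proof (rule Bochner_Integration.integral_cong[OF refl])
    fix x :: "real^'n" assume "x \<in> space hyp_volume"
    then have "x \<in> hyp"
      by (simp add: hyp_volume_def space_restrict_space)
    then show "A x * R_p p x ((u x / lam powr (1 / (p - 1))) *\<^sub>R X x) (lam *\<^sub>R hyp_grad u x)
        = ?c1 * ?F1 x + ?c2 * ?F2 x - ?E x"
      unfolding R_p_scaleR[OF assms(1,2) \<open>x \<in> hyp\<close>] by (simp only: algebra_simps)
  qed
  also have "\<dots> = ?c1 * (\<integral>x. ?F1 x \<partial>hyp_volume) + ?c2 * (\<integral>x. ?F2 x \<partial>hyp_volume)
      - (\<integral>x. ?E x \<partial>hyp_volume)"
    using vol(1)[OF supp(1) cont1] vol(1)[OF supp(2) cont2] vol(1)[OF supp(3) contE] by simp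
  \<comment> \<open>By \<open>div\<close>, the term \<open>- div_integral\<close> equals the
    integral of \<open>?E\<close> and cancels the mixed term.\<close>
  finally show ?thesis
    using div by simp
qed

end
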